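(* Let $\alpha,\beta,\gamma,a,b,c,z\in\mathbb{C}$ with $\mathrm{Re}(c)>\mathrm{Re}(b)>0$ and $\mathrm{Re}(\alpha)>0$, and suppose that either $p>0$, or $p=0$ and $|\arg(1-z)|<\pi$. Then $${}^{ML}F_{p}(a,b;c;z)=\frac{1}{B(b,c-b)}\int_{0}^{1}t^{b-1}(1-t)^{c-b-1}(1-zt)^{-a}E_{\alpha,\beta}^{\gamma}\left(-\frac{p}{t(1-t)}\right)dt,$$ $${}^{ML}F_{p}(a,b;c;z)=\frac{1}{B(b,c-b)}\int_{0}^{\infty}u^{b-1}(1+u)^{a-c}(1+u(1-z))^{-a}E_{\alpha,\beta}^{\gamma}\left(-p\left(2+u+\frac{1}{u}\right)\right)du,$$ $${}^{ML}F_{p}(a,b;c;z)=\frac{2}{B(b,c-b)}\int_{0}^{\pi/2}\sin^{2b-1}v\,\cos^{2c-2b-1}v\,(1-z\sin^{2}v)^{-a}E_{\alpha,\beta}^{\gamma}\left(-p\sec^{2}v\csc^{2}v\right)dv,$$ $${}^{ML}F_{p}(a,b;c;z)=\frac{2}{B(b,c-b)}\int_{0}^{\infty}\sinh^{2b-1}v\,\cosh^{2a-2c+1}v\,(\cosh^{2}v-z\sinh^{2}v)^{-a}E_{\alpha,\beta}^{\gamma}\left(-p\cosh^{2}v\coth^{2}v\right)dv.$$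
   Context: The three-parameter Mittag-Leffler function is $E_{\alpha,\beta}^{\gamma}(z)=\sum_{n=0}^{\infty}\frac{(\gamma)_n}{\Gamma(\alpha n+\beta)}\frac{z^n}{n!}$ for $\alpha,\beta,\gamma\in\mathbb{C}$, $\mathrm{Re}(\alpha)>0$, where $(\gamma)_n=\gamma(\gamma+1)\cdots(\gamma+n-1)$, $(\gamma)_0=1$. The ML-generalized beta function is ${}^{ML}B_{p}(x,y)=\int_{0}^{1}t^{x-1}(1-t)^{y-1}E_{\alpha,\beta}^{\gamma}\left(-\frac{p}{t(1-t)}\right)dt$ for $\mathrm{Re}(x)>0$, $\mathrm{Re}(y)>0$ (the parameters $\alpha,\beta,\gamma$ are suppressed in the notation), and $B(x,y)=\int_0^1 t^{x-1}(1-t)^{y-1}dt$ is the classical beta function. The ML-generalized Gauss hypergeometric function is defined by ${}^{ML}F_{p}(a,b;c;z)=\sum_{n=0}^{\infty}(a)_n\frac{{}^{ML}B_{p}(b+n,c-b)}{B(b,c-b)}\frac{z^n}{n!}$ for $p\ge 0$, $|z|<1$, $\mathrm{Re}(c)>\mathrm{Re}(b)>0$, $\mathrm{Re}(\alpha)>0$.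
   Formalization: For p>0 the formal theorem also assumes that the integral defining ^{ML}B_p(b,c-b) converges; without this F_p can be undefined (e.g. α=β=1, γ=-1, Re(b)≤1). |z|<1 is assumed, as in the definition of F_p. *)

theory Defs
  imports "HOL-Analysis.Analysis"
begin

(* In the library 1 / Gamma is the entire function rGamma, also at the poles of Gamma. *)
definition mittag_leffler3 :: "complex \<Rightarrow> complex \<Rightarrow> complex \<Rightarrow> complex \<Rightarrow> complex" where
  "mittag_leffler3 \<alpha> \<beta> \<gamma> z =
     (\<Sum>n. pochhammer \<gamma> n / Gamma (\<alpha> * of_nat n + \<beta>) * (z ^ n / fact n))"

(* Complex powers are principal values. The integrand takes junk values at the endpoints t = 0
   and t = 1 (division by zero), which do not affect the integral. *)
definition ml_beta_integrand ::
    "complex \<Rightarrow> complex \<Rightarrow> complex \<Rightarrow> real \<Rightarrow> complex \<Rightarrow> complex \<Rightarrow> real \<Rightarrow> complex" where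
  "ml_beta_integrand \<alpha> \<beta> \<gamma> p x y t =
     complex_of_real t powr (x - 1) * complex_of_real (1 - t) powr (y - 1)
       * mittag_leffler3 \<alpha> \<beta> \<gamma> (complex_of_real (- (p / (t * (1 - t)))))"

(* The gauge integral also covers improper, conditionally convergent integrals, which do
   occur here (for instance for \<alpha> = 2). *)
definition ml_beta :: "complex \<Rightarrow> complex \<Rightarrow> complex \<Rightarrow> real \<Rightarrow> complex \<Rightarrow> complex \<Rightarrow> complex" where
  "ml_beta \<alpha> \<beta> \<gamma> p x y = integral {0..1} (ml_beta_integrand \<alpha> \<beta> \<gamma> p x y)"

definition ml_hypergeom_term ::
    "complex \<Rightarrow> complex \<Rightarrow> complex \<Rightarrow> real \<Rightarrow> complex \<Rightarrow> complex \<Rightarrow> complex \<Rightarrow> complex \<Rightarrow> nat \<Rightarrow> complex" where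
  "ml_hypergeom_term \<alpha> \<beta> \<gamma> p a b c z n =
     pochhammer a n * (ml_beta \<alpha> \<beta> \<gamma> p (b + of_nat n) (c - b) / Beta b (c - b)) * (z ^ n / fact n)"

(* Meaningful for p \<ge> 0, norm z < 1, Re c > Re b > 0 and Re \<alpha> > 0. *)
definition ml_hypergeom ::
    "complex \<Rightarrow> complex \<Rightarrow> complex \<Rightarrow> real \<Rightarrow> complex \<Rightarrow> complex \<Rightarrow> complex \<Rightarrow> complex \<Rightarrow> complex" where
  "ml_hypergeom \<alpha> \<beta> \<gamma> p a b c z = (\<Sum>n. ml_hypergeom_term \<alpha> \<beta> \<gamma> p a b c z n)"

end

theory Submission
  imports Defs "HOL-Real_Asymp.Real_Asymp"
begin

text \<open>
  The beta integrand need only be integrable in the gauge sense, so neither dominated convergence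
  nor Fubini is available to integrate the binomial series of \<open>(1 - z t) powr (- a)\<close> term by term.
  Instead, the coefficients are split into four nonnegative sequences. Every remainder of a power
  series with nonnegative coefficients is monotone on \<open>[0, 1]\<close>, and the second mean value theorem
  bounds the integral of a nonnegative increasing \<open>g\<close> times \<open>f\<close> by \<open>M * g 1\<close> with \<open>M\<close>
  depending only on \<open>f\<close>; hence the remainders vanish in the limit.

  The other three formulas arise from \<open>t = u / (1 + u)\<close>, \<open>t = sin\<^sup>2 v\<close> and \<open>t = tanh\<^sup>2 v\<close>. A strictly
  increasing differentiable substitution transports tagged divisions, so it preserves the gauge
  integral of an arbitrary integrable function, and no regularity of the Mittag-Leffler function
  is needed. The half-line integrals are limits of integrals over \<open>[0, R]\<close>.
\<close>

section \<open>Change of variables for the gauge integral\<close>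

lemma image_Icc_strict_mono_on:
  fixes g :: "real \<Rightarrow> real"
  assumes "strict_mono_on {u..v} g" "continuous_on {u..v} g" "u \<le> v"
  shows "g ` {u..v} = {g u..g v}"
proof (intro equalityI subsetI)
  fix y assume "y \<in> g ` {u..v}"
  then show "y \<in> {g u..g v}"
    using assms(1,3) by (auto simp: strict_mono_on_leD)
next
  fix y assume "y \<in> {g u..g v}"
  then show "y \<in> g ` {u..v}"
    using IVT'[of g u y v] assms by auto
qed

text \<open>The image of a tagged division of \<open>{a..b}\<close> under \<open>g\<close> is a
  tagged division of \<open>{g a..g b}\<close>. The Riemann sums of \<open>f\<close> over the image
  and of the new integrand over the original differ only by replacing the length of the image of
  \<open>K\<close> by \<open>g' x\<close> times the length of \<open>K\<close>. Differentiability at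
  the tag makes this error small relative to the length of \<open>K\<close>.\<close>

lemma has_integral_substitution_strict_mono_on:
  fixes f :: "real \<Rightarrow> 'a::real_normed_vector" and g g' :: "real \<Rightarrow> real"
  assumes "a \<le> b" and mono: "strict_mono_on {a..b} g"
    and deriv: "\<And>x. x \<in> {a..b} \<Longrightarrow> (g has_real_derivative g' x) (at x within {a..b})"
    and f: "(f has_integral I) {g a..g b}"
  shows "((\<lambda>x. g' x *\<^sub>R f (g x)) has_integral I) {a..b}"
  unfolding has_integral_real
proof (intro allI impI)
  fix e :: real assume "e > 0"
  have cont: "continuous_on {a..b} g"
    using deriv DERIV_continuous_on by blast
  from f \<open>e > 0\<close> obtain d where "gauge d" and
    d: "\<And>p. p tagged_division_of {g a..g b} \<Longrightarrow> d fine p \<Longrightarrow>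
          norm ((\<Sum>(x,K)\<in>p. measure lborel K *\<^sub>R f x) - I) < e / 2"
    unfolding has_integral_real by (metis half_gt_zero)
  \<comment> \<open>Scaling the derivative error at \<open>x\<close> by \<open>norm (f (g x))\<close> handles unbounded \<open>f\<close>.\<close>
  define C where "C = e / (2 * (b - a + 1))"
  have "C > 0" using \<open>e > 0\<close> \<open>a \<le> b\<close> by (simp add: C_def)
  define \<epsilon> where "\<epsilon> x = C / (1 + norm (f (g x)))" for x
  have \<epsilon>: "\<epsilon> x > 0" "\<epsilon> x * norm (f (g x)) \<le> C" for x
    using \<open>C > 0\<close> norm_ge_zero[of "f (g x)"] by (auto simp: \<epsilon>_def field_simps add_pos_nonneg)
  \<comment> \<open>One radius at each tag has to serve two purposes: the image must be fine for
    \<open>d\<close>, and the linear approximation of \<open>g\<close> must be accurate up to the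
    factor \<open>\<epsilon> x\<close>.\<close>
  have "\<exists>\<delta>>0. \<forall>y\<in>{a..b}. \<bar>y - x\<bar> < \<delta> \<longrightarrow>
          g y \<in> d (g x) \<and> \<bar>g y - g x - g' x * (y - x)\<bar> \<le> \<epsilon> x * \<bar>y - x\<bar>"
    if x: "x \<in> {a..b}" for x
  proof -
    obtain \<delta>1 where \<delta>1: "\<delta>1 > 0"
      "\<And>y. y \<in> {a..b} \<Longrightarrow> \<bar>y - x\<bar> < \<delta>1 \<Longrightarrow> \<bar>g y - g x - g' x * (y - x)\<bar> \<le> \<epsilon> x * \<bar>y - x\<bar>"
      using deriv[OF x] \<epsilon>(1)[of x] unfolding has_field_derivative_def has_derivative_within_alt
      by (metis real_norm_def)
    obtain r where r: "r > 0" "ball (g x) r \<subseteq> d (g x)"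
      using \<open>gauge d\<close> by (metis gauge_def openE)
    obtain \<delta>2 where \<delta>2: "\<delta>2 > 0" "\<And>y. y \<in> {a..b} \<Longrightarrow> \<bar>y - x\<bar> < \<delta>2 \<Longrightarrow> dist (g y) (g x) < r"
      using cont x r(1) unfolding continuous_on_iff by (metis dist_real_def)
    show ?thesis
      using \<delta>1 \<delta>2 r by (intro exI[of _ "min \<delta>1 \<delta>2"]) (auto simp: dist_commute subset_iff)
  qed
  then obtain \<delta> where \<delta>: "\<And>x. x \<in> {a..b} \<Longrightarrow> \<delta> x > 0"
    "\<And>x y. x \<in> {a..b} \<Longrightarrow> y \<in> {a..b} \<Longrightarrow> \<bar>y - x\<bar> < \<delta> x \<Longrightarrow> g y \<in> d (g x)"
    "\<And>x y. x \<in> {a..b} \<Longrightarrow> y \<in> {a..b} \<Longrightarrow> \<bar>y - x\<bar> < \<delta> x \<Longrightarrow>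
       \<bar>g y - g x - g' x * (y - x)\<bar> \<le> \<epsilon> x * \<bar>y - x\<bar>"
    by metis
  \<comment> \<open>The radius 1 outside \<open>{a..b}\<close> is arbitrary: no tag lies there, but
    a gauge must be defined on the whole line.\<close>
  define D where "D x = ball x (if x \<in> {a..b} then \<delta> x else 1)" for x
  have "gauge D"
    using \<delta>(1) by (auto simp: D_def gauge_def)
  have "norm ((\<Sum>(x,K)\<in>p. measure lborel K *\<^sub>R (g' x *\<^sub>R f (g x))) - I) < e"
    if p: "p tagged_division_of {a..b}" and fine: "D fine p" for p
  proof -
    note pD = tagged_division_ofD[OF p]
    define h where "h = (\<lambda>(x, K). (g x, g ` K))"
    have intv: "\<exists>u v. u \<le> v \<and> K = {u..v} \<and> x \<in> {u..v} \<and> {u..v} \<subseteq> {a..b} \<and> g ` K = {g u..g v} \<and> g u \<le> g v"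
      if xK: "(x, K) \<in> p" for x K
    proof -
      obtain u v where K: "K = {u..v}" using pD(4)[OF xK] by auto
      have sub: "x \<in> {u..v}" "{u..v} \<subseteq> {a..b}" using pD(2,3)[OF xK] K by auto
      then have "u \<le> v" by auto
      moreover have "g ` {u..v} = {g u..g v}"
        using sub \<open>u \<le> v\<close> mono cont
        by (intro image_Icc_strict_mono_on monotone_on_subset[OF mono] continuous_on_subset[OF cont])
      ultimately show ?thesis
        using K sub by (metis atLeastatMost_empty_iff empty_is_image)
    qed
    have inj: "inj_on g {a..b}"
      using mono strict_mono_on_imp_inj_on by blast
    \<comment> \<open>Injectivity lets the sum over the image division be reindexed as a sum over
      \<open>p\<close>.\<close>
    have injh: "inj_on h p"
    proof (rule inj_onI)
      fix s t assume st: "s \<in> p" "t \<in> p" "h s = h t"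
      obtain x K y L where xy: "s = (x, K)" "t = (y, L)" by fastforce
      have "x \<in> {a..b}" "y \<in> {a..b}" "K \<subseteq> {a..b}" "L \<subseteq> {a..b}"
        using pD(2,3) st xy by blast+
      then show "s = t"
        using st(3) inj unfolding xy h_def by (simp add: inj_on_image_eq_iff inj_on_eq_iff)
    qed
    have "h ` p tagged_division_of {g a..g b}"
    proof (rule tagged_division_ofI)
      show "finite (h ` p)" using pD(1) by simp
      fix x K assume "(x, K) \<in> h ` p"
      then obtain y L where yL: "(y, L) \<in> p" "x = g y" "K = g ` L"
        by (auto simp: h_def)
      obtain u v where uv: "y \<in> {u..v}" "L = {u..v}" "{u..v} \<subseteq> {a..b}" "g ` L = {g u..g v}"
        using intv[OF yL(1)] by blast
      show "x \<in> K" using yL uv by auto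
      show "\<exists>a b. K = cbox a b" using yL uv by auto
      show "K \<subseteq> {g a..g b}"
        using uv yL(3) image_Icc_strict_mono_on[OF mono cont \<open>a \<le> b\<close>] by auto
    next
      fix x1 K1 x2 K2
      assume A: "(x1, K1) \<in> h ` p" "(x2, K2) \<in> h ` p" "(x1, K1) \<noteq> (x2, K2)"
      obtain y1 L1 where 1: "(y1, L1) \<in> p" "x1 = g y1" "K1 = g ` L1"
        using A(1) by (auto simp: h_def)
      obtain y2 L2 where 2: "(y2, L2) \<in> p" "x2 = g y2" "K2 = g ` L2"
        using A(2) by (auto simp: h_def)
      have ne: "(y1, L1) \<noteq> (y2, L2)" using A(3) 1 2 by auto
      obtain u1 v1 where uv1: "u1 \<le> v1" "L1 = {u1..v1}" "{u1..v1} \<subseteq> {a..b}" "g ` L1 = {g u1..g v1}"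
        using intv[OF 1(1)] by blast
      obtain u2 v2 where uv2: "u2 \<le> v2" "L2 = {u2..v2}" "{u2..v2} \<subseteq> {a..b}" "g ` L2 = {g u2..g v2}"
        using intv[OF 2(1)] by blast
      show "interior K1 \<inter> interior K2 = {}"
      proof (rule ccontr)
        assume "interior K1 \<inter> interior K2 \<noteq> {}"
        then obtain y where "y \<in> interior {g u1..g v1}" "y \<in> interior {g u2..g v2}"
          using 1(3) 2(3) uv1(4) uv2(4) by (metis disjoint_iff)
        then have y: "g u1 < y" "y < g v1" "g u2 < y" "y < g v2" by auto
        \<comment> \<open>As \<open>y\<close> avoids the values at the endpoints, its unique
          preimage is interior to both \<open>L1\<close> and \<open>L2\<close>, which are
          non-overlapping.\<close>
        have "y \<in> g ` L1" "y \<in> g ` L2" using y uv1 uv2 by auto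
        then obtain s t where st: "s \<in> {u1..v1}" "y = g s" "t \<in> {u2..v2}" "y = g t"
          using uv1(2) uv2(2) by blast
        then have "s = t" using inj uv1(3) uv2(3) by (metis inj_onD subsetD)
        then have "s \<in> {u1<..<v1}" "s \<in> {u2<..<v2}" using st y by (auto simp: less_le)
        then have "s \<in> interior L1 \<inter> interior L2" by (auto simp: uv1 uv2)
        then show False using pD(5)[OF 1(1) 2(1) ne] by blast
      qed
    next
      have "{K. \<exists>x. (x, K) \<in> h ` p} = (`) g ` {K. \<exists>x. (x, K) \<in> p}"
        unfolding h_def by (auto intro: rev_image_eqI)
      then have "\<Union>{K. \<exists>x. (x, K) \<in> h ` p} = g ` (\<Union>{K. \<exists>x. (x, K) \<in> p})"
        by (simp only: image_Union)
      then show "\<Union>{K. \<exists>x. (x, K) \<in> h ` p} = {g a..g b}"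
        using pD(6) image_Icc_strict_mono_on[OF mono cont \<open>a \<le> b\<close>] by simp
    qed
    moreover have "d fine (h ` p)"
    proof (rule fineI)
      fix x K assume "(x, K) \<in> h ` p"
      then obtain y L where yL: "(y, L) \<in> p" "x = g y" "K = g ` L"
        by (auto simp: h_def)
      have "L \<subseteq> D y" "y \<in> {a..b}" "L \<subseteq> {a..b}" using fine yL(1) pD(2,3) by blast+
      then have "g w \<in> d (g y)" if "w \<in> L" for w
        using that by (intro \<delta>(2)) (auto simp: D_def dist_real_def subset_iff)
      then show "K \<subseteq> d x" using yL by auto
    qed
    ultimately have "norm ((\<Sum>(x,K)\<in>h ` p. measure lborel K *\<^sub>R f x) - I) < e / 2"
      by (rule d)
    also have "(\<Sum>(x,K)\<in>h ` p. measure lborel K *\<^sub>R f x) = (\<Sum>(x,K)\<in>p. measure lborel (g ` K) *\<^sub>R f (g x))"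
      by (subst sum.reindex[OF injh]) (simp add: h_def case_prod_unfold)
    finally have 1: "norm ((\<Sum>(x,K)\<in>p. measure lborel (g ` K) *\<^sub>R f (g x)) - I) < e / 2" .
    have "norm ((\<Sum>(x,K)\<in>p. measure lborel K *\<^sub>R (g' x *\<^sub>R f (g x))) - (\<Sum>(x,K)\<in>p. measure lborel (g ` K) *\<^sub>R f (g x)))
       = norm (\<Sum>(x,K)\<in>p. (measure lborel K * g' x - measure lborel (g ` K)) *\<^sub>R f (g x))"
      by (simp add: sum_subtractf[symmetric] case_prod_unfold algebra_simps)
    also have "\<dots> \<le> (\<Sum>(x,K)\<in>p. C * measure lborel K)"
    proof (rule sum_norm_le, clarify)
      fix x K assume xK: "(x, K) \<in> p"
      obtain u v where uv: "u \<le> v" "K = {u..v}" "x \<in> {u..v}" "{u..v} \<subseteq> {a..b}" "g ` K = {g u..g v}" "g u \<le> g v"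
        using intv[OF xK] by blast
      have DK: "K \<subseteq> D x" using fine xK by blast
      have x: "x \<in> {a..b}" "u \<in> {a..b}" "v \<in> {a..b}" using uv by auto
      have "u \<in> D x" "v \<in> D x" using DK uv by auto
      then have uv\<delta>: "\<bar>u - x\<bar> < \<delta> x" "\<bar>v - x\<bar> < \<delta> x" using x by (auto simp: D_def dist_real_def)
      \<comment> \<open>The increment is split at the tag. Because \<open>u \<le> x \<le> v\<close>,
        the two errors add up to at most \<open>\<epsilon> x * (v - u)\<close>, with no loss when
        the tag is close to one end.\<close>
      have "g v - g u - g' x * (v - u) = (g v - g x - g' x * (v - x)) - (g u - g x - g' x * (u - x))"
        by (simp add: algebra_simps)
      then have "\<bar>g v - g u - g' x * (v - u)\<bar>
          \<le> \<bar>g v - g x - g' x * (v - x)\<bar> + \<bar>g u - g x - g' x * (u - x)\<bar>"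
        by (simp only: abs_triangle_ineq4)
      also have "\<dots> \<le> \<epsilon> x * \<bar>v - x\<bar> + \<epsilon> x * \<bar>u - x\<bar>"
        by (intro add_mono \<delta>(3) x uv\<delta>)
      also have "\<dots> = \<epsilon> x * (v - u)"
        using uv(3) by (simp add: distrib_left[symmetric])
      finally have *: "\<bar>measure lborel K * g' x - measure lborel (g ` K)\<bar> \<le> \<epsilon> x * (v - u)"
        using uv by (simp add: abs_minus_commute mult.commute)
      have "norm ((measure lborel K * g' x - measure lborel (g ` K)) *\<^sub>R f (g x)) \<le> \<epsilon> x * (v - u) * norm (f (g x))"
        using * by (simp add: mult_right_mono)
      also have "\<dots> = \<epsilon> x * norm (f (g x)) * (v - u)" by simp
      also have "\<dots> \<le> C * (v - u)" using \<epsilon>(2) uv(1) by (intro mult_right_mono) auto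
      finally show "norm ((measure lborel K * g' x - measure lborel (g ` K)) *\<^sub>R f (g x)) \<le> C * measure lborel K"
        using uv by simp
    qed
    also have "\<dots> = C * (b - a)"
      using additive_content_tagged_division[of p a b] p \<open>a \<le> b\<close>
      by (simp add: sum_distrib_left[symmetric] case_prod_unfold)
    \<comment> \<open>The summand 1 in the denominator of \<open>C\<close> makes the estimate strict
      and covers \<open>a = b\<close>.\<close>
    also have "\<dots> < e / 2"
      using \<open>e > 0\<close> \<open>a \<le> b\<close> by (simp add: C_def field_simps)
    finally have 2: "norm ((\<Sum>(x,K)\<in>p. measure lborel K *\<^sub>R (g' x *\<^sub>R f (g x)))
        - (\<Sum>(x,K)\<in>p. measure lborel (g ` K) *\<^sub>R f (g x))) < e / 2" .
    show ?thesis
      using 1 2 dist_triangle[of "\<Sum>(x,K)\<in>p. measure lborel K *\<^sub>R (g' x *\<^sub>R f (g x))" I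
          "\<Sum>(x,K)\<in>p. measure lborel (g ` K) *\<^sub>R f (g x)"]
      unfolding dist_norm by linarith
  qed
  with \<open>gauge D\<close> show "\<exists>\<gamma>. gauge \<gamma> \<and> (\<forall>p. p tagged_division_of {a..b} \<and> \<gamma> fine p \<longrightarrow>
      norm ((\<Sum>(x,K)\<in>p. measure lborel K *\<^sub>R (g' x *\<^sub>R f (g x))) - I) < e)"
    by (intro exI[of _ D] conjI allI impI) blast+
qed

text \<open>The half-line case of Hake's theorem. The integral over an unbounded set is tested on
  large boxes with the integrand extended by zero, and a box reaching left of \<open>a\<close> only
  sees \<open>{a..r}\<close>.\<close>

lemma has_integral_atLeast_tendsto:
  fixes f :: "real \<Rightarrow> 'a::banach"
  assumes f: "\<And>R. R \<ge> a \<Longrightarrow> (f has_integral J R) {a..R}" and J: "(J \<longlongrightarrow> I) at_top"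
  shows "(f has_integral I) {a..}"
proof -
  let ?F = "\<lambda>x. if x \<in> {a..} then f x else 0"
  have F: "(?F has_integral (if a \<le> r then J r else 0)) {l..r}" if "l \<le> a" for l r
  proof (cases "a \<le> r")
    case True
    have "((\<lambda>x. if x \<in> {a..r} then f x else 0) has_integral J r) {l..r}"
      using that f[OF True] by (subst has_integral_restrict) auto
    then have "(?F has_integral J r) {l..r}"
      by (rule has_integral_eq[rotated]) auto
    then show ?thesis using True that by simp
  next
    case False
    have "(?F has_integral 0) {l..r}"
      by (rule has_integral_is_0) (use False in auto)
    then show ?thesis using False that by simp
  qed
  show ?thesis
    unfolding has_integral_alt'
  proof (intro conjI allI impI)
    fix l r :: real
    \<comment> \<open>A box that starts to the right of \<open>a\<close> is enlarged to the left
      first, so that the formula for \<open>?F\<close> applies.\<close>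
    have "?F integrable_on {min l a..r}" using F[of "min l a" r] by (auto simp: integrable_on_def)
    then show "?F integrable_on cbox l r"
      unfolding cbox_interval by (rule integrable_on_subinterval) auto
  next
    fix e :: real assume "e > 0"
    then obtain R where R: "\<And>r. r \<ge> R \<Longrightarrow> norm (J r - I) < e"
      using J unfolding tendsto_iff eventually_at_top_linorder dist_norm by blast
    \<comment> \<open>Any interval containing \<open>{-B<..<B}\<close> starts left of
      \<open>a\<close> and ends beyond both \<open>a\<close> and \<open>R\<close>.\<close>
    define B where "B = \<bar>a\<bar> + \<bar>R\<bar> + 1"
    have "norm (integral (cbox l r) ?F - I) < e" if "ball 0 B \<subseteq> cbox l r" for l r
    proof -
      have *: "ball (0::real) B = {-B<..<B}"
        by (auto simp: dist_real_def)
      have "{-B<..<B} \<subseteq> {l..r}" using that unfolding * by simp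
      then have "l \<le> -B" "B \<le> r"
        using B_def by (auto simp: greaterThanLessThan_subseteq_atLeastAtMost_iff)
      then have "l \<le> a" "a \<le> r" "R \<le> r" by (auto simp: B_def)
      then show ?thesis
        using F[of l r] R[of r] by (simp add: integral_unique)
    qed
    then show "\<exists>B>0. \<forall>l r. ball 0 B \<subseteq> cbox l r \<longrightarrow> norm (integral (cbox l r) ?F - I) < e"
      by (intro exI[of _ B]) (auto simp: B_def)
  qed
qed

text \<open>The substitution on each \<open>{a..R}\<close> gives the integral of \<open>f\<close> up
  to \<open>g R\<close>. The value \<open>B\<close> is only approached, and the passage to the limit
  rests on the continuity of the indefinite integral at \<open>B\<close>.\<close>

lemma has_integral_substitution_atLeast:
  fixes f :: "real \<Rightarrow> 'a::banach" and g g' :: "real \<Rightarrow> real"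
  assumes mono: "strict_mono_on {a..} g"
    and deriv: "\<And>x. x \<ge> a \<Longrightarrow> (g has_real_derivative g' x) (at x)"
    and lim: "(g \<longlongrightarrow> B) at_top"
    and f: "(f has_integral I) {g a..B}"
  shows "((\<lambda>x. g' x *\<^sub>R f (g x)) has_integral I) {a..}"
proof (rule has_integral_atLeast_tendsto)
  define J where "J y = integral {g a..y} f" for y
  have le: "g a \<le> g R" "g R \<le> B" if "R \<ge> a" for R
  proof -
    show "g a \<le> g R" using mono that by (simp add: strict_mono_on_leD)
    show "g R \<le> B"
      using lim by (rule tendsto_lowerbound)
        (use that mono in \<open>auto intro!: eventually_mono[OF eventually_ge_at_top[of R]] simp: strict_mono_on_leD\<close>)
  qed
  show "((\<lambda>x. g' x *\<^sub>R f (g x)) has_integral J (g R)) {a..R}" if "R \<ge> a" for R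
  proof (rule has_integral_substitution_strict_mono_on[OF that])
    show "strict_mono_on {a..R} g" by (rule monotone_on_subset[OF mono]) auto
    show "(g has_real_derivative g' x) (at x within {a..R})" if "x \<in> {a..R}" for x
      using that deriv[of x] by (auto intro: has_field_derivative_at_within)
    have "f integrable_on {g a..g R}"
      by (rule integrable_on_subinterval[of _ "{g a..B}"]) (use f le[OF that] in auto)
    then show "(f has_integral J (g R)) {g a..g R}"
      by (simp add: J_def integrable_integral)
  qed
  have "continuous_on {g a..B} J"
    unfolding J_def by (rule indefinite_integral_continuous_1) (use f in auto)
  moreover have "J B = I" using f by (simp add: J_def integral_unique)
  moreover have "B \<in> {g a..B}" using le[of a] by auto
  ultimately have "(J \<longlongrightarrow> I) (at B within {g a..B})"
    by (auto simp: continuous_on_def)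
  then have "((\<lambda>R. J (g R)) \<longlongrightarrow> J B) at_top"
    using \<open>continuous_on {g a..B} J\<close> \<open>B \<in> {g a..B}\<close> le lim
    by (intro continuous_on_tendsto_compose[of "{g a..B}" J])
       (auto intro: eventually_mono[OF eventually_ge_at_top[of a]])
  then show "((\<lambda>R. J (g R)) \<longlongrightarrow> I) at_top" using \<open>J B = I\<close> by simp
qed

section \<open>Termwise integration of power series against a gauge integrable function\<close>

text \<open>By the second mean value theorem the integral equals \<open>g a\<close> times the
  integral of \<open>f\<close> over \<open>{a..c}\<close> plus \<open>g b\<close> times that over
  \<open>{c..b}\<close>. Only \<open>c\<close> depends on \<open>g\<close>, and integrals of
  \<open>f\<close> over subintervals are uniformly bounded, so \<open>M\<close> can be chosen before
  \<open>g\<close>.\<close>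

lemma bounded_integral_mono_on_mult_real:
  fixes f :: "real \<Rightarrow> real"
  assumes f: "f integrable_on {a..b}" and "a \<le> b"
  obtains M where "\<And>g. mono_on {a..b} g \<Longrightarrow> 0 \<le> g a \<Longrightarrow>
    (\<lambda>x. g x * f x) integrable_on {a..b} \<and> \<bar>integral {a..b} (\<lambda>x. g x * f x)\<bar> \<le> M * g b"
proof -
  \<comment> \<open>The indefinite integral is continuous, hence bounded on the compact interval,
    even when \<open>f\<close> is not absolutely integrable.\<close>
  have "compact ((\<lambda>x. integral {a..x} f) ` {a..b})"
    by (intro compact_continuous_image indefinite_integral_continuous_1 f) auto
  then obtain B where "\<forall>y\<in>(\<lambda>x. integral {a..x} f) ` {a..b}. norm y \<le> B"
    by (elim compact_imp_bounded[THEN bounded_iff[THEN iffD1], THEN exE])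
  then have B: "\<And>x. x \<in> {a..b} \<Longrightarrow> \<bar>integral {a..x} f\<bar> \<le> B"
    by auto
  \<comment> \<open>One \<open>B\<close> bounds the integral over \<open>{a..c}\<close>; the
    integral over \<open>{c..b}\<close> is a difference of two indefinite integrals and costs
    \<open>2 * B\<close>.\<close>
  have "(\<lambda>x. g x * f x) integrable_on {a..b} \<and> \<bar>integral {a..b} (\<lambda>x. g x * f x)\<bar> \<le> (3 * B) * g b"
    if g: "mono_on {a..b} g" "0 \<le> g a" for g
  proof -
    obtain c where c: "c \<in> {a..b}" and
      int: "((\<lambda>x. g x * f x) has_integral (g a * integral {a..c} f + g b * integral {c..b} f)) {a..b}"
      by (rule second_mean_value_theorem_full[OF f \<open>a \<le> b\<close>, of g])
         (use g in \<open>auto simp: mono_on_def\<close>)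
    have gab: "g a \<le> g b" using g(1) \<open>a \<le> b\<close> by (auto simp: mono_on_def)
    have "integral {a..c} f + integral {c..b} f = integral {a..b} f"
      using c f by (intro Henstock_Kurzweil_Integration.integral_combine) auto
    then have "\<bar>integral {c..b} f\<bar> \<le> 2 * B"
      using B[of c] B[of b] c \<open>a \<le> b\<close> by (simp add: abs_le_iff)
    moreover have "\<bar>g a * integral {a..c} f\<bar> \<le> g b * B"
      unfolding abs_mult by (rule mult_mono) (use B[of c] c g(2) gab in auto)
    ultimately have "\<bar>g a * integral {a..c} f\<bar> \<le> g b * B" "\<bar>g b * integral {c..b} f\<bar> \<le> g b * (2 * B)"
      using g(2) gab by (simp_all add: abs_mult mult_left_mono)
    then have "\<bar>g a * integral {a..c} f + g b * integral {c..b} f\<bar> \<le> 3 * B * g b"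
      using abs_triangle_ineq[of "g a * integral {a..c} f" "g b * integral {c..b} f"]
      by (simp add: algebra_simps)
    with int show ?thesis by (auto simp: has_integral_iff)
  qed
  then show ?thesis by (rule that)
qed

lemma has_integral_complexI:
  assumes "((\<lambda>x. Re (f x)) has_integral Re I) A" "((\<lambda>x. Im (f x)) has_integral Im I) A"
  shows "(f has_integral I) A"
  using assms by (subst has_integral_componentwise_iff) (auto simp: Basis_complex_def)

text \<open>The real weight \<open>g\<close> acts separately on the real and imaginary parts of
  \<open>f\<close>, whose bounds add up because the modulus is at most the sum of the absolute
  values of the two parts.\<close>

lemma bounded_integral_mono_on_mult_complex:
  fixes f :: "real \<Rightarrow> complex"
  assumes f: "f integrable_on {a..b}" and "a \<le> b"
  obtains M where "\<And>g. mono_on {a..b} g \<Longrightarrow> 0 \<le> g a \<Longrightarrow>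
    (\<lambda>x. of_real (g x) * f x) integrable_on {a..b} \<and>
    norm (integral {a..b} (\<lambda>x. of_real (g x) * f x)) \<le> M * g b"
proof -
  have Re_Im: "(\<lambda>x. Re (f x)) integrable_on {a..b}" "(\<lambda>x. Im (f x)) integrable_on {a..b}"
    using f has_integral_Re has_integral_Im unfolding integrable_on_def by blast+
  obtain M1 where M1: "\<And>g. mono_on {a..b} g \<Longrightarrow> 0 \<le> g a \<Longrightarrow>
      (\<lambda>x. g x * Re (f x)) integrable_on {a..b} \<and> \<bar>integral {a..b} (\<lambda>x. g x * Re (f x))\<bar> \<le> M1 * g b"
    using bounded_integral_mono_on_mult_real[OF Re_Im(1) \<open>a \<le> b\<close>] by blast
  obtain M2 where M2: "\<And>g. mono_on {a..b} g \<Longrightarrow> 0 \<le> g a \<Longrightarrow>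
      (\<lambda>x. g x * Im (f x)) integrable_on {a..b} \<and> \<bar>integral {a..b} (\<lambda>x. g x * Im (f x))\<bar> \<le> M2 * g b"
    using bounded_integral_mono_on_mult_real[OF Re_Im(2) \<open>a \<le> b\<close>] by blast
  have "(\<lambda>x. of_real (g x) * f x) integrable_on {a..b} \<and>
      norm (integral {a..b} (\<lambda>x. of_real (g x) * f x)) \<le> (M1 + M2) * g b"
    if g: "mono_on {a..b} g" "0 \<le> g a" for g
  proof -
    define I where "I = Complex (integral {a..b} (\<lambda>x. g x * Re (f x))) (integral {a..b} (\<lambda>x. g x * Im (f x)))"
    have "((\<lambda>x. of_real (g x) * f x) has_integral I) {a..b}"
      by (rule has_integral_complexI) (use M1[OF g] M2[OF g] in \<open>auto simp: I_def has_integral_integral\<close>)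
    moreover have "norm I \<le> (M1 + M2) * g b"
      using cmod_le[of I] M1[OF g] M2[OF g] by (simp add: I_def algebra_simps)
    ultimately show ?thesis by (auto simp: has_integral_iff)
  qed
  then show ?thesis by (rule that)
qed

lemma sums_integral_nonneg_power_series_mult:
  fixes f :: "real \<Rightarrow> complex" and d :: "nat \<Rightarrow> real"
  assumes f: "f integrable_on {0..1}" and d: "\<And>n. 0 \<le> d n" "summable d"
  obtains I where "((\<lambda>t. of_real (\<Sum>n. d n * t ^ n) * f t) has_integral I) {0..1}"
    "(\<lambda>n. of_real (d n) * integral {0..1} (\<lambda>t. of_real t ^ n * f t)) sums I"
proof -
  obtain M where M: "\<And>g. mono_on {0..1} g \<Longrightarrow> 0 \<le> g 0 \<Longrightarrow>
      (\<lambda>x. of_real (g x) * f x) integrable_on {0..1} \<and>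
      norm (integral {0..1} (\<lambda>x. of_real (g x) * f x)) \<le> M * g 1"
    using bounded_integral_mono_on_mult_complex[OF f] by auto
  define m where "m n = integral {0..1} (\<lambda>t. of_real t ^ n * f t)" for n
  have m: "((\<lambda>t. of_real t ^ n * f t) has_integral m n) {0..1}" for n
    using M[of "\<lambda>t. t ^ n"] by (simp add: m_def has_integral_integral mono_on_def power_mono)
  have sm: "summable (\<lambda>n. d n * t ^ n)" if "t \<in> {0..1}" for t
    by (rule summable_comparison_test'[OF d(2), of 0])
       (use that d in \<open>auto simp: mult_left_le power_le_one abs_mult\<close>)
  \<comment> \<open>The remainder keeps its original exponents, so \<open>g 0\<close> is the full
    sum and \<open>g N\<close> is what is left after subtracting the first \<open>N\<close>
    terms.\<close>
  define g where "g N t = (\<Sum>n. d (n + N) * t ^ (n + N))" for N t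
  have g_split: "g 0 t = g N t + (\<Sum>n<N. d n * t ^ n)" if "t \<in> {0..1}" for N t
    using suminf_split_initial_segment[OF sm[OF that], of N] by (simp add: g_def)
  have mono: "mono_on {0..1} (g N)" for N
    unfolding g_def
    by (auto simp: mono_on_def intro!: suminf_le mult_left_mono power_mono d
          summable_ignore_initial_segment[OF sm])
  have nonneg: "0 \<le> g N 0" for N
    unfolding g_def by (intro suminf_nonneg summable_ignore_initial_segment[OF sm]) (auto simp: d)
  define I where "I = integral {0..1} (\<lambda>t. of_real (g 0 t) * f t)"
  have I: "((\<lambda>t. of_real (g 0 t) * f t) has_integral I) {0..1}"
    using M[OF mono nonneg, of 0] by (simp add: I_def has_integral_integral)
  \<comment> \<open>The error of the partial sum is exactly the integral of the remainder times
    \<open>f\<close>, to which the monotone bound applies.\<close>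
  have norm_le: "norm (I - (\<Sum>n<N. of_real (d n) * m n)) \<le> M * g N 1" for N
  proof -
    have "((\<lambda>t. of_real (g 0 t) * f t - (\<Sum>n<N. of_real (d n) * (of_real t ^ n * f t)))
       has_integral (I - (\<Sum>n<N. of_real (d n) * m n))) {0..1}"
      by (intro has_integral_diff I has_integral_sum has_integral_mult_right m) auto
    moreover have "of_real (g 0 t) * f t - (\<Sum>n<N. of_real (d n) * (of_real t ^ n * f t)) = of_real (g N t) * f t"
      if "t \<in> {0..1}" for t
      unfolding g_split[OF that, of N] by (simp add: algebra_simps sum_distrib_left)
    ultimately have "((\<lambda>t. of_real (g N t) * f t) has_integral (I - (\<Sum>n<N. of_real (d n) * m n))) {0..1}"
      by (rule has_integral_eq[rotated])
    then show ?thesis using M[OF mono nonneg, of N] by (simp add: integral_unique)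
  qed
  have lim: "(\<lambda>N. M * g N 1) \<longlonglongrightarrow> M * 0"
  proof (intro tendsto_mult tendsto_const)
    \<comment> \<open>At \<open>t = 1\<close> the remainder is the tail of the convergent series of
      the \<open>d n\<close>.\<close>
    have "(\<lambda>N. g 0 1 - (\<Sum>n<N. d n)) \<longlonglongrightarrow> g 0 1 - (\<Sum>n. d n)"
      by (intro tendsto_intros summable_LIMSEQ d)
    moreover have "g N 1 = g 0 1 - (\<Sum>n<N. d n)" for N
      using g_split[of 1 N] by simp
    ultimately show "(\<lambda>N. g N 1) \<longlonglongrightarrow> 0"
      by (simp add: g_def)
  qed
  have "(\<lambda>N. I - (\<Sum>n<N. of_real (d n) * m n)) \<longlonglongrightarrow> 0"
    by (rule Lim_null_comparison[OF always_eventually[OF allI[OF norm_le]]]) (use lim in simp)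
  from tendsto_diff[OF tendsto_const[of I] this]
  have "(\<lambda>n. of_real (d n) * m n) sums I"
    unfolding sums_def by simp
  with I show ?thesis by (intro that[of I]) (simp_all add: g_def m_def)
qed

text \<open>The positive and negative parts of the real and imaginary parts of \<open>c n\<close>
  are nonnegative and bounded by \<open>norm (c n)\<close>. The nonnegative case applies to each of
  the four series, and linearity recombines them.\<close>

lemma sums_integral_power_series_mult:
  fixes f :: "real \<Rightarrow> complex" and c :: "nat \<Rightarrow> complex"
  assumes f: "f integrable_on {0..1}" and c: "summable (\<lambda>n. norm (c n))"
  obtains I where "((\<lambda>t. (\<Sum>n. c n * of_real t ^ n) * f t) has_integral I) {0..1}"
    "(\<lambda>n. c n * integral {0..1} (\<lambda>t. of_real t ^ n * f t)) sums I"
proof -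
  define m where "m n = integral {0..1} (\<lambda>t. of_real t ^ n * f t)" for n
  define d where "d i n = max 0 (if i = 0 then Re (c n) else if i = 1 then - Re (c n)
     else if i = 2 then Im (c n) else - Im (c n))" for i n :: nat
  have d: "0 \<le> d i n" "d i n \<le> norm (c n)" for i n
    using abs_Re_le_cmod[of "c n"] abs_Im_le_cmod[of "c n"] by (auto simp: d_def)
  have sd: "summable (d i)" for i
    by (rule summable_comparison_test'[OF c, of 0]) (use d in auto)
  have st: "summable (\<lambda>n. d i n * t ^ n)" if "t \<in> {0..1}" for i t
    by (rule summable_comparison_test'[OF sd[of i], of 0])
       (use that d in \<open>auto simp: mult_left_le power_le_one abs_mult\<close>)
  \<comment> \<open>The unit with which the part \<open>d i\<close> enters \<open>c\<close>.\<close>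
  define s where "s i = (if i = 0 then 1 else if i = 1 then - 1 else if i = 2 then \<i> else - \<i>)" for i :: nat
  have sum4: "(\<Sum>i<4. h i) = h 0 + h 1 + h 2 + h 3" for h :: "nat \<Rightarrow> complex"
    by (simp add: eval_nat_numeral)
  have c_eq: "c n = (\<Sum>i<4. s i * of_real (d i n))" for n
    unfolding sum4 by (simp add: s_def d_def complex_eq_iff max_def)
  have "\<exists>I. ((\<lambda>t. of_real (\<Sum>n. d i n * t ^ n) * f t) has_integral I) {0..1} \<and>
     (\<lambda>n. of_real (d i n) * m n) sums I" for i
    unfolding m_def by (rule sums_integral_nonneg_power_series_mult[OF f d(1) sd]) blast
  then obtain I where I: "\<And>i. ((\<lambda>t. of_real (\<Sum>n. d i n * t ^ n) * f t) has_integral I i) {0..1}"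
     "\<And>i. (\<lambda>n. of_real (d i n) * m n) sums I i" by metis
  have "(\<lambda>n. \<Sum>i<4. s i * (of_real (d i n) * m n)) sums (\<Sum>i<4. s i * I i)"
    by (intro sums_sum sums_mult I)
  then have sums: "(\<lambda>n. c n * m n) sums (\<Sum>i<4. s i * I i)"
    unfolding c_eq by (simp add: sum_distrib_right mult.assoc)
  have "((\<lambda>t. \<Sum>i<4. s i * (of_real (\<Sum>n. d i n * t ^ n) * f t)) has_integral (\<Sum>i<4. s i * I i)) {0..1}"
    by (intro has_integral_sum has_integral_mult_right I) auto
  moreover have "(\<Sum>i<4. s i * (of_real (\<Sum>n. d i n * t ^ n) * f t)) = (\<Sum>n. c n * of_real t ^ n) * f t"
    if "t \<in> {0..1}" for t
  proof -
    have "(\<lambda>n. \<Sum>i<4. s i * of_real (d i n * t ^ n)) sums (\<Sum>i<4. s i * of_real (\<Sum>n. d i n * t ^ n))"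
      by (intro sums_sum sums_mult sums_of_real summable_sums st that)
    then have "(\<Sum>n. c n * of_real t ^ n) = (\<Sum>i<4. s i * of_real (\<Sum>n. d i n * t ^ n))"
      unfolding c_eq by (intro sums_unique[symmetric]) (simp add: sum_distrib_right mult.assoc)
    then show ?thesis by (simp add: sum_distrib_right mult.assoc)
  qed
  ultimately have "((\<lambda>t. (\<Sum>n. c n * of_real t ^ n) * f t) has_integral (\<Sum>i<4. s i * I i)) {0..1}"
    by (rule has_integral_eq[rotated])
  with sums show ?thesis unfolding m_def by (rule that[rotated])
qed

section \<open>Binomial series, the classical beta integrand and complex powers\<close>

text \<open>Newton's binomial series at \<open>- z\<close> with exponent \<open>- a\<close>: the
  signs of the generalized binomial coefficient and of \<open>(- z) ^ n\<close> cancel. Absolute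
  convergence holds inside the disc of convergence.\<close>

lemma sums_one_minus_powr:
  fixes a z :: complex
  assumes "norm z < 1"
  shows "(\<lambda>n. pochhammer a n / fact n * z ^ n) sums (1 - z) powr (- a)"
    and "summable (\<lambda>n. norm (pochhammer a n / fact n * z ^ n))"
proof -
  have eq: "(- a gchoose n) * (- z) ^ n = pochhammer a n / fact n * z ^ n" for n
    unfolding gbinomial_pochhammer power_minus[of z] by (simp add: power_mult_distrib[symmetric])
  show "(\<lambda>n. pochhammer a n / fact n * z ^ n) sums (1 - z) powr (- a)"
    using gen_binomial_complex[of "- z" "- a"] assms by (simp add: eq)
  have "ereal (norm (- z)) < conv_radius (\<lambda>n. - a gchoose n)"
    using assms by (simp add: conv_radius_gchoose)
  then have "summable (\<lambda>n. norm ((- a gchoose n) * (- z) ^ n))"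
    by (rule abs_summable_in_conv_radius)
  then show "summable (\<lambda>n. norm (pochhammer a n / fact n * z ^ n))"
    unfolding eq .
qed

text \<open>On the open interval the integrand is continuous and its modulus is the real beta
  integrand with exponents \<open>Re x - 1\<close> and \<open>Re y - 1\<close>. This settles
  integrability when \<open>p = 0\<close>.\<close>

lemma integrable_Beta_complex:
  fixes x y :: complex
  assumes "Re x > 0" "Re y > 0"
  shows "(\<lambda>t. complex_of_real t powr (x - 1) * complex_of_real (1 - t) powr (y - 1)) integrable_on {0..1}"
proof -
  let ?f = "\<lambda>t. complex_of_real t powr (x - 1) * complex_of_real (1 - t) powr (y - 1)"
  have "?f absolutely_integrable_on {0<..<1}"
  proof (rule measurable_bounded_by_integrable_imp_absolutely_integrable)
    show "?f \<in> borel_measurable (lebesgue_on {0<..<1})"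
      by (intro continuous_imp_measurable_on_sets_lebesgue continuous_intros)
         (auto simp: complex_nonpos_Reals_iff)
    show "(\<lambda>t. t powr (Re x - 1) * (1 - t) powr (Re y - 1)) integrable_on {0<..<1}"
      using integrable_Beta'[OF assms] by (simp add: integrable_on_Icc_iff_Ioo)
    show "norm (?f t) \<le> t powr (Re x - 1) * (1 - t) powr (Re y - 1)" if "t \<in> {0<..<1}" for t
      using that by (simp add: norm_mult norm_powr_real_powr del: of_real_diff)
  qed auto
  then show ?thesis
    by (simp add: absolutely_integrable_on_def integrable_on_Icc_iff_Ioo)
qed

lemma of_real_powr_exp:
  "r > 0 \<Longrightarrow> complex_of_real r powr w = exp (w * of_real (ln r))"
  by (simp add: powr_def Ln_of_real)

lemma of_real_exp_ln:
  "r > 0 \<Longrightarrow> complex_of_real r = exp (of_real (ln r))"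
  by (metis exp_ln exp_of_real)

text \<open>With \<open>t = s^2\<close> and \<open>1 - t = k^2\<close>, the derivative factor
  \<open>2 * s * k\<close> raises the exponents \<open>2 * (b - 1)\<close> and
  \<open>2 * (c - b - 1)\<close> by one. All bases are positive, so everything reduces to
  exponentials of real logarithms.\<close>

lemma powr_sin_cos_substitution:
  fixes s k :: real
  assumes "s > 0" "k > 0"
  shows "complex_of_real (2 * s * k) *
      (complex_of_real (s\<^sup>2) powr (b - 1) * complex_of_real (k\<^sup>2) powr (c - b - 1))
    = 2 * (complex_of_real s powr (2 * b - 1) * complex_of_real k powr (2 * c - 2 * b - 1))"
proof -
  have "complex_of_real (s * k) = exp (of_real (ln (s * k)))"
    using assms by (intro of_real_exp_ln) auto
  moreover have "ln (s\<^sup>2) = 2 * ln s" "ln (k\<^sup>2) = 2 * ln k" "ln (s * k) = ln s + ln k"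
    using assms by (simp_all add: ln_realpow ln_mult)
  ultimately have "complex_of_real (s * k) *
      (complex_of_real (s\<^sup>2) powr (b - 1) * complex_of_real (k\<^sup>2) powr (c - b - 1))
    = complex_of_real s powr (2 * b - 1) * complex_of_real k powr (2 * c - 2 * b - 1)"
    using assms by (simp add: of_real_powr_exp del: of_real_power of_real_mult flip: exp_add)
      (simp add: algebra_simps)
  moreover have "complex_of_real (2 * s * k) = 2 * complex_of_real (s * k)"
    by simp
  ultimately show ?thesis by (simp only: mult.assoc)
qed

text \<open>Here \<open>q\<close> stands for \<open>1 + u\<close>. The positive factor
  \<open>1 / q\<close> can be split off the principal power of a complex base without a branch
  correction; the exponents of \<open>q\<close> then add up to
  \<open>- 2 - (b - 1) - (c - b - 1) + a = a - c\<close>.\<close>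

lemma powr_rational_substitution:
  fixes u q :: real and w :: complex
  assumes "u > 0" "q > 0"
  shows "complex_of_real (1 / q\<^sup>2) *
      (complex_of_real (u / q) powr (b - 1) * complex_of_real (1 / q) powr (c - b - 1)
        * (complex_of_real (1 / q) * w) powr (- a))
    = complex_of_real u powr (b - 1) * complex_of_real q powr (a - c) * w powr (- a)"
proof -
  have w: "(complex_of_real (1 / q) * w) powr (- a) = complex_of_real (1 / q) powr (- a) * w powr (- a)"
    using assms by (intro powr_times_real_left) auto
  have "complex_of_real (1 / q\<^sup>2) = exp (of_real (ln (1 / q\<^sup>2)))"
    using assms by (intro of_real_exp_ln) auto
  moreover have "ln (1 / q\<^sup>2) = - 2 * ln q" "ln (u / q) = ln u - ln q" "ln (1 / q) = - ln q"
    using assms by (simp_all add: ln_div ln_realpow)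
  ultimately have "complex_of_real (1 / q\<^sup>2) *
      (complex_of_real (u / q) powr (b - 1) * complex_of_real (1 / q) powr (c - b - 1)
        * complex_of_real (1 / q) powr (- a))
    = complex_of_real u powr (b - 1) * complex_of_real q powr (a - c)"
    using assms by (simp add: of_real_powr_exp del: of_real_power of_real_divide flip: exp_add)
      (simp add: algebra_simps)
  then show ?thesis unfolding w by (simp only: mult.assoc[symmetric])
qed

text \<open>Here \<open>s\<close> and \<open>k\<close> stand for \<open>sinh v\<close> and
  \<open>cosh v\<close>. The derivative contributes \<open>k\<close> to the power -3, and the total
  exponent of \<open>k\<close> is
  \<open>- 3 - 2 * (b - 1) - 2 * (c - b - 1) + 2 * a\<close>.\<close>

lemma powr_hyperbolic_substitution:
  fixes s k :: real and w :: complex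
  assumes "s > 0" "k > 0"
  shows "complex_of_real (2 * (s / k) * (1 / k\<^sup>2)) *
      (complex_of_real (s\<^sup>2 / k\<^sup>2) powr (b - 1) * complex_of_real (1 / k\<^sup>2) powr (c - b - 1)
        * (complex_of_real (1 / k\<^sup>2) * w) powr (- a))
    = 2 * (complex_of_real s powr (2 * b - 1) * complex_of_real k powr (2 * a - 2 * c + 1) * w powr (- a))"
proof -
  have w: "(complex_of_real (1 / k\<^sup>2) * w) powr (- a) = complex_of_real (1 / k\<^sup>2) powr (- a) * w powr (- a)"
    using assms by (intro powr_times_real_left) auto
  have "complex_of_real (s / k * (1 / k\<^sup>2)) = exp (of_real (ln (s / k * (1 / k\<^sup>2))))"
    using assms by (intro of_real_exp_ln) auto
  moreover have "ln (1 / k\<^sup>2) = - 2 * ln k" "ln (s\<^sup>2 / k\<^sup>2) = 2 * ln s - 2 * ln k"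
    "ln (s / k * (1 / k\<^sup>2)) = ln s - 3 * ln k"
    using assms by (simp_all add: ln_div ln_mult ln_realpow)
  ultimately have "complex_of_real (s / k * (1 / k\<^sup>2)) *
      (complex_of_real (s\<^sup>2 / k\<^sup>2) powr (b - 1) * complex_of_real (1 / k\<^sup>2) powr (c - b - 1)
        * complex_of_real (1 / k\<^sup>2) powr (- a))
    = complex_of_real s powr (2 * b - 1) * complex_of_real k powr (2 * a - 2 * c + 1)"
    using assms by (simp add: of_real_powr_exp del: of_real_power of_real_divide of_real_mult flip: exp_add)
      (simp add: algebra_simps)
  from arg_cong[OF this, of "\<lambda>x. 2 * (x * w powr (- a))"]
  have "2 * complex_of_real (s / k * (1 / k\<^sup>2)) *
      (complex_of_real (s\<^sup>2 / k\<^sup>2) powr (b - 1) * complex_of_real (1 / k\<^sup>2) powr (c - b - 1)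
        * (complex_of_real (1 / k\<^sup>2) * w) powr (- a))
    = 2 * (complex_of_real s powr (2 * b - 1) * complex_of_real k powr (2 * a - 2 * c + 1) * w powr (- a))"
    unfolding w by (simp only: mult.assoc)
  moreover have "complex_of_real (2 * (s / k) * (1 / k\<^sup>2)) = 2 * complex_of_real (s / k * (1 / k\<^sup>2))"
    by simp
  ultimately show ?thesis by (simp only:)
qed

section \<open>The Euler integral of the hypergeometric series\<close>

text \<open>For \<open>p = 0\<close> the Mittag-Leffler argument is 0 throughout, also at the
  endpoints where \<open>0 / 0 = 0\<close>, so that factor is a constant.\<close>

lemma ml_beta_integrand_0_integrable:
  assumes "Re x > 0" "Re y > 0"
  shows "ml_beta_integrand \<alpha> \<beta> \<gamma> 0 x y integrable_on {0..1}"
proof -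
  obtain i where "((\<lambda>t. complex_of_real t powr (x - 1) * complex_of_real (1 - t) powr (y - 1)) has_integral i) {0..1}"
    using integrable_Beta_complex[OF assms] by (auto simp: integrable_on_def)
  from has_integral_mult_left[OF this, of "mittag_leffler3 \<alpha> \<beta> \<gamma> 0"] show ?thesis
    unfolding ml_beta_integrand_def[abs_def] integrable_on_def by auto
qed

text \<open>Turns the coefficients of the hypergeometric series into moments of one fixed integrand,
  as termwise integration requires.\<close>

lemma ml_beta_add_nat:
  "ml_beta \<alpha> \<beta> \<gamma> p (x + of_nat n) y = integral {0..1} (\<lambda>t. of_real t ^ n * ml_beta_integrand \<alpha> \<beta> \<gamma> p x y t)"
  unfolding ml_beta_def
proof (rule integral_spike[of "{0}"])
  fix t :: real assume "t \<in> {0..1} - {0}"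
  then have t: "complex_of_real t \<noteq> 0" by simp
  have "complex_of_real t powr (x + of_nat n - 1) = of_real t powr (of_nat n + (x - 1))"
    by (simp add: algebra_simps)
  also have "\<dots> = of_real t ^ n * of_real t powr (x - 1)"
    using t by (simp only: powr_add powr_nat' simp_thms)
  finally show "of_real t ^ n * ml_beta_integrand \<alpha> \<beta> \<gamma> p x y t = ml_beta_integrand \<alpha> \<beta> \<gamma> p (x + of_nat n) y t"
    by (simp add: ml_beta_integrand_def)
qed auto

text \<open>Since \<open>norm (z * t) < 1\<close> on all of \<open>{0..1}\<close>, the binomial
  series represents the factor \<open>(1 - z * t) powr (- a)\<close> there. Integrating it termwise
  against the beta integrand yields both the convergence of the hypergeometric series and its
  sum.\<close>

lemma ml_hypergeom_sums_Euler_integral: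
  assumes f: "ml_beta_integrand \<alpha> \<beta> \<gamma> p b (c - b) integrable_on {0..1}" and z: "norm z < 1"
  obtains J where "((\<lambda>t. complex_of_real t powr (b - 1) * complex_of_real (1 - t) powr (c - b - 1)
             * (1 - z * complex_of_real t) powr (- a)
             * mittag_leffler3 \<alpha> \<beta> \<gamma> (complex_of_real (- (p / (t * (1 - t)))))) has_integral J) {0..1}"
    "ml_hypergeom_term \<alpha> \<beta> \<gamma> p a b c z sums (1 / Beta b (c - b) * J)"
proof -
  let ?C = "\<lambda>n. pochhammer a n / fact n * z ^ n"
  let ?f = "ml_beta_integrand \<alpha> \<beta> \<gamma> p b (c - b)"
  obtain J where J: "((\<lambda>t. (\<Sum>n. ?C n * of_real t ^ n) * ?f t) has_integral J) {0..1}"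
    "(\<lambda>n. ?C n * integral {0..1} (\<lambda>t. of_real t ^ n * ?f t)) sums J"
    using sums_integral_power_series_mult[OF f sums_one_minus_powr(2)[OF z]] by blast
  show ?thesis
  proof (rule that)
    show "((\<lambda>t. complex_of_real t powr (b - 1) * complex_of_real (1 - t) powr (c - b - 1)
             * (1 - z * complex_of_real t) powr (- a)
             * mittag_leffler3 \<alpha> \<beta> \<gamma> (complex_of_real (- (p / (t * (1 - t)))))) has_integral J) {0..1}"
    proof (rule has_integral_eq[OF _ J(1)])
      fix t :: real assume "t \<in> {0..1}"
      then have "norm (z * of_real t) < 1"
        using z mult_left_le[of "\<bar>t\<bar>" "norm z"] by (simp add: norm_mult)
      then have "(\<Sum>n. ?C n * of_real t ^ n) = (1 - z * of_real t) powr (- a)"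
        using sums_unique[OF sums_one_minus_powr(1)] by (simp add: power_mult_distrib mult.assoc)
      then show "(\<Sum>n. ?C n * of_real t ^ n) * ?f t = complex_of_real t powr (b - 1)
          * complex_of_real (1 - t) powr (c - b - 1) * (1 - z * complex_of_real t) powr (- a)
          * mittag_leffler3 \<alpha> \<beta> \<gamma> (complex_of_real (- (p / (t * (1 - t)))))"
        by (simp add: ml_beta_integrand_def)
    qed
    have "(\<lambda>n. 1 / Beta b (c - b) * (?C n * integral {0..1} (\<lambda>t. of_real t ^ n * ?f t)))
        = ml_hypergeom_term \<alpha> \<beta> \<gamma> p a b c z"
      by (simp add: fun_eq_iff ml_hypergeom_term_def ml_beta_add_nat)
    with sums_mult[OF J(2), of "1 / Beta b (c - b)"]
    show "ml_hypergeom_term \<alpha> \<beta> \<gamma> p a b c z sums (1 / Beta b (c - b) * J)"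
      by simp
  qed
qed

section \<open>The three substitutions\<close>

lemma has_integral_rational_substitution:
  fixes f :: "real \<Rightarrow> 'a::banach"
  assumes "(f has_integral I) {0..1}"
  shows "((\<lambda>u. (1 / (1 + u)\<^sup>2) *\<^sub>R f (u / (1 + u))) has_integral I) {0..}"
proof (rule has_integral_substitution_atLeast)
  show "strict_mono_on {0..} (\<lambda>u::real. u / (1 + u))"
    by (auto simp: strict_mono_on_def field_simps)
  show "((\<lambda>u. u / (1 + u)) has_real_derivative 1 / (1 + u)\<^sup>2) (at u)" if "u \<ge> 0" for u
    using that by (auto intro!: derivative_eq_intros simp: power2_eq_square)
  show "((\<lambda>u::real. u / (1 + u)) \<longlongrightarrow> 1) at_top"
    by real_asymp
qed (use assms in simp)

text \<open>The derivative vanishes at both ends, yet the squared sine is strictly increasing on the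
  closed interval, so the substitution on compact intervals applies directly.\<close>

lemma has_integral_sin_square_substitution:
  fixes f :: "real \<Rightarrow> 'a::real_normed_vector"
  assumes "(f has_integral I) {0..1}"
  shows "((\<lambda>v. (2 * sin v * cos v) *\<^sub>R f ((sin v)\<^sup>2)) has_integral I) {0..pi / 2}"
proof (rule has_integral_substitution_strict_mono_on)
  show "strict_mono_on {0..pi / 2} (\<lambda>v. (sin v)\<^sup>2)"
    by (auto simp: strict_mono_on_def sin_monotone_2pi sin_ge_zero intro!: power_strict_mono)
  show "((\<lambda>v. (sin v)\<^sup>2) has_real_derivative 2 * sin v * cos v) (at v within {0..pi / 2})" for v
    by (auto intro!: derivative_eq_intros)
qed (use assms in auto)

lemma has_integral_tanh_square_substitution:
  fixes f :: "real \<Rightarrow> 'a::banach"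
  assumes "(f has_integral I) {0..1}"
  shows "((\<lambda>v. (2 * tanh v * (1 - (tanh v)\<^sup>2)) *\<^sub>R f ((tanh v)\<^sup>2)) has_integral I) {0..}"
proof (rule has_integral_substitution_atLeast)
  show "strict_mono_on {0..} (\<lambda>v::real. (tanh v)\<^sup>2)"
    by (auto simp: strict_mono_on_def intro!: power_strict_mono)
  show "((\<lambda>v. (tanh v)\<^sup>2) has_real_derivative 2 * tanh v * (1 - (tanh v)\<^sup>2)) (at v)" for v :: real
    by (auto intro!: derivative_eq_intros)
  show "((\<lambda>v::real. (tanh v)\<^sup>2) \<longlongrightarrow> 1) at_top"
    using tendsto_power[OF tanh_real_at_top, of 2] by simp
qed (use assms in simp)

section \<open>The four integral representations\<close>

theorem theorem3p1:
  fixes \<alpha> \<beta> \<gamma> a b c z :: complex and p :: real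
  assumes "Re c > Re b" and "Re b > 0" and "Re \<alpha> > 0"
    and "norm z < 1"
    and "p > 0 \<or> (p = 0 \<and> \<bar>Arg (1 - z)\<bar> < pi)"
    and "p > 0 \<Longrightarrow> ml_beta_integrand \<alpha> \<beta> \<gamma> p b (c - b) integrable_on {0..1}"
  shows
    "summable (ml_hypergeom_term \<alpha> \<beta> \<gamma> p a b c z) \<and>
     (\<exists>I. ((\<lambda>t. complex_of_real t powr (b - 1) * complex_of_real (1 - t) powr (c - b - 1)
             * (1 - z * complex_of_real t) powr (- a)
             * mittag_leffler3 \<alpha> \<beta> \<gamma> (complex_of_real (- (p / (t * (1 - t))))))
           has_integral I) {0..1}
        \<and> ml_hypergeom \<alpha> \<beta> \<gamma> p a b c z = 1 / Beta b (c - b) * I) \<and>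
     (\<exists>I. ((\<lambda>u. complex_of_real u powr (b - 1) * complex_of_real (1 + u) powr (a - c)
             * (1 + complex_of_real u * (1 - z)) powr (- a)
             * mittag_leffler3 \<alpha> \<beta> \<gamma> (complex_of_real (- p * (2 + u + 1 / u))))
           has_integral I) {0..}
        \<and> ml_hypergeom \<alpha> \<beta> \<gamma> p a b c z = 1 / Beta b (c - b) * I) \<and>
     (\<exists>I. ((\<lambda>v. complex_of_real (sin v) powr (2 * b - 1)
             * complex_of_real (cos v) powr (2 * c - 2 * b - 1)
             * (1 - z * complex_of_real ((sin v)\<^sup>2)) powr (- a)
             * mittag_leffler3 \<alpha> \<beta> \<gamma> (complex_of_real (- p * (1 / cos v)\<^sup>2 * (1 / sin v)\<^sup>2)))
           has_integral I) {0..pi / 2}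
        \<and> ml_hypergeom \<alpha> \<beta> \<gamma> p a b c z = 2 / Beta b (c - b) * I) \<and>
     (\<exists>I. ((\<lambda>v. complex_of_real (sinh v) powr (2 * b - 1)
             * complex_of_real (cosh v) powr (2 * a - 2 * c + 1)
             * (complex_of_real ((cosh v)\<^sup>2) - z * complex_of_real ((sinh v)\<^sup>2)) powr (- a)
             * mittag_leffler3 \<alpha> \<beta> \<gamma> (complex_of_real (- p * (cosh v)\<^sup>2 * (cosh v / sinh v)\<^sup>2)))
           has_integral I) {0..}
        \<and> ml_hypergeom \<alpha> \<beta> \<gamma> p a b c z = 2 / Beta b (c - b) * I)"
proof -
  have f: "ml_beta_integrand \<alpha> \<beta> \<gamma> p b (c - b) integrable_on {0..1}"
    using assms(5,6) ml_beta_integrand_0_integrable[of b "c - b"] assms(1,2) by auto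
  define G where "G t = complex_of_real t powr (b - 1) * complex_of_real (1 - t) powr (c - b - 1)
             * (1 - z * complex_of_real t) powr (- a)
             * mittag_leffler3 \<alpha> \<beta> \<gamma> (complex_of_real (- (p / (t * (1 - t)))))" for t
  obtain J where J: "(G has_integral J) {0..1}"
    and sums: "ml_hypergeom_term \<alpha> \<beta> \<gamma> p a b c z sums (1 / Beta b (c - b) * J)"
    using ml_hypergeom_sums_Euler_integral[OF f assms(4), of a] unfolding G_def[abs_def] by blast
  have H: "ml_hypergeom \<alpha> \<beta> \<gamma> p a b c z = 1 / Beta b (c - b) * J"
    using sums by (simp add: ml_hypergeom_def sums_unique[symmetric])
  \<comment> \<open>The trigonometric and hyperbolic substitutions produce a factor 2, which the
    stated formulas carry in front of the integral; the integral itself is therefore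
    \<open>J / 2\<close>.\<close>
  have H2: "ml_hypergeom \<alpha> \<beta> \<gamma> p a b c z = 2 / Beta b (c - b) * (J / 2)"
    using H by simp

  have half: "y = x / 2" if "x = 2 * y" for x y :: complex
    using that by simp

  have int_u: "((\<lambda>u. complex_of_real u powr (b - 1) * complex_of_real (1 + u) powr (a - c)
             * (1 + complex_of_real u * (1 - z)) powr (- a)
             * mittag_leffler3 \<alpha> \<beta> \<gamma> (complex_of_real (- p * (2 + u + 1 / u))))
           has_integral J) {0..}"
  \<comment> \<open>The point \<open>u = 0\<close>, where \<open>1 / u\<close> is only a default
    value, is discarded as negligible.\<close>
  proof (rule has_integral_spike_finite[OF _ _ has_integral_rational_substitution[OF J]])
    fix u :: real assume "u \<in> {0..} - {0}"
    then have u: "u > 0" "1 + u > 0" by auto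
    \<comment> \<open>With \<open>t = u / (1 + u)\<close> one has
      \<open>1 / (t * (1 - t)) = (1 + u)^2 / u = 2 + u + 1 / u\<close>.\<close>
    have eqs: "1 - u / (1 + u) = 1 / (1 + u)"
      "p / (u / (1 + u) * (1 / (1 + u))) = p * (2 + u + 1 / u)"
      using u by (simp_all add: field_simps)
    have w: "1 - z * complex_of_real (u / (1 + u))
        = complex_of_real (1 / (1 + u)) * (1 + complex_of_real u * (1 - z))"
    proof -
      have "1 + complex_of_real u \<noteq> 0" using u by (metis of_real_1 of_real_add of_real_eq_0_iff less_irrefl)
      then show ?thesis by (simp add: field_simps)
    qed
    have "(1 / (1 + u)\<^sup>2) *\<^sub>R G (u / (1 + u)) = complex_of_real (1 / (1 + u)\<^sup>2) *
        (complex_of_real (u / (1 + u)) powr (b - 1) * complex_of_real (1 / (1 + u)) powr (c - b - 1)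
          * (complex_of_real (1 / (1 + u)) * (1 + complex_of_real u * (1 - z))) powr (- a))
        * mittag_leffler3 \<alpha> \<beta> \<gamma> (complex_of_real (- p * (2 + u + 1 / u)))"
      unfolding G_def scaleR_conv_of_real eqs w by (simp only: mult.assoc mult_minus_left)
    then show "complex_of_real u powr (b - 1) * complex_of_real (1 + u) powr (a - c)
             * (1 + complex_of_real u * (1 - z)) powr (- a)
             * mittag_leffler3 \<alpha> \<beta> \<gamma> (complex_of_real (- p * (2 + u + 1 / u)))
       = (1 / (1 + u)\<^sup>2) *\<^sub>R G (u / (1 + u))"
      by (simp only: powr_rational_substitution[OF u])
  qed auto

  have int_sin: "((\<lambda>v. complex_of_real (sin v) powr (2 * b - 1)
             * complex_of_real (cos v) powr (2 * c - 2 * b - 1)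
             * (1 - z * complex_of_real ((sin v)\<^sup>2)) powr (- a)
             * mittag_leffler3 \<alpha> \<beta> \<gamma> (complex_of_real (- p * (1 / cos v)\<^sup>2 * (1 / sin v)\<^sup>2)))
           has_integral (J / 2)) {0..pi / 2}"
  \<comment> \<open>Both endpoints are discarded, so that sine and cosine are positive and the power
    laws apply.\<close>
  proof (rule has_integral_spike_finite[OF _ _ has_integral_divide[OF has_integral_sin_square_substitution[OF J]]])
    fix v assume "v \<in> {0..pi / 2} - {0, pi / 2}"
    then have v: "sin v > 0" "cos v > 0" by (auto intro!: sin_gt_zero cos_gt_zero_pi)
    have eqs: "1 - (sin v)\<^sup>2 = (cos v)\<^sup>2"
      "- (p / ((sin v)\<^sup>2 * (cos v)\<^sup>2)) = - p * (1 / cos v)\<^sup>2 * (1 / sin v)\<^sup>2"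
      by (simp_all add: cos_squared_eq power_divide field_simps)
    have "(2 * sin v * cos v) *\<^sub>R G ((sin v)\<^sup>2) = complex_of_real (2 * sin v * cos v) *
        (complex_of_real ((sin v)\<^sup>2) powr (b - 1) * complex_of_real ((cos v)\<^sup>2) powr (c - b - 1))
        * (1 - z * complex_of_real ((sin v)\<^sup>2)) powr (- a)
        * mittag_leffler3 \<alpha> \<beta> \<gamma> (complex_of_real (- p * (1 / cos v)\<^sup>2 * (1 / sin v)\<^sup>2))"
      unfolding G_def scaleR_conv_of_real eqs by (simp only: mult.assoc)
    then have "(2 * sin v * cos v) *\<^sub>R G ((sin v)\<^sup>2) = 2 * (complex_of_real (sin v) powr (2 * b - 1)
             * complex_of_real (cos v) powr (2 * c - 2 * b - 1)
             * (1 - z * complex_of_real ((sin v)\<^sup>2)) powr (- a)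
             * mittag_leffler3 \<alpha> \<beta> \<gamma> (complex_of_real (- p * (1 / cos v)\<^sup>2 * (1 / sin v)\<^sup>2)))"
      unfolding powr_sin_cos_substitution[OF v] by (simp only: mult.assoc)
    then show "complex_of_real (sin v) powr (2 * b - 1)
             * complex_of_real (cos v) powr (2 * c - 2 * b - 1)
             * (1 - z * complex_of_real ((sin v)\<^sup>2)) powr (- a)
             * mittag_leffler3 \<alpha> \<beta> \<gamma> (complex_of_real (- p * (1 / cos v)\<^sup>2 * (1 / sin v)\<^sup>2))
       = ((2 * sin v * cos v) *\<^sub>R G ((sin v)\<^sup>2)) / 2"
      by (rule half)
  qed auto

  have int_sinh: "((\<lambda>v. complex_of_real (sinh v) powr (2 * b - 1)
             * complex_of_real (cosh v) powr (2 * a - 2 * c + 1)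
             * (complex_of_real ((cosh v)\<^sup>2) - z * complex_of_real ((sinh v)\<^sup>2)) powr (- a)
             * mittag_leffler3 \<alpha> \<beta> \<gamma> (complex_of_real (- p * (cosh v)\<^sup>2 * (cosh v / sinh v)\<^sup>2)))
           has_integral (J / 2)) {0..}"
  proof (rule has_integral_spike_finite[OF _ _ has_integral_divide[OF has_integral_tanh_square_substitution[OF J]]])
    fix v :: real assume "v \<in> {0..} - {0}"
    then have v: "sinh v > 0" "cosh v > 0" by auto
    have tanh: "tanh v = sinh v / cosh v" "(tanh v)\<^sup>2 = (sinh v)\<^sup>2 / (cosh v)\<^sup>2"
      by (simp_all add: tanh_def power_divide)
    have eqs: "1 - (sinh v)\<^sup>2 / (cosh v)\<^sup>2 = 1 / (cosh v)\<^sup>2"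
      using hyperbolic_pythagoras[of v] v by (simp add: diff_divide_eq_iff)
    have arg: "- (p / ((sinh v)\<^sup>2 / (cosh v)\<^sup>2 * (1 / (cosh v)\<^sup>2))) = - p * (cosh v)\<^sup>2 * (cosh v / sinh v)\<^sup>2"
    proof -
      \<comment> \<open>This holds for all real \<open>x\<close> and \<open>y\<close>, including 0,
        because division by zero gives 0.\<close>
      have "p / (y / x * (1 / x)) = p * x * (x / y)" for x y :: real
        by simp
      then show ?thesis by (simp only: power_divide mult_minus_left)
    qed
    \<comment> \<open>The positive factor \<open>1 - (tanh v)^2 = 1 / (cosh v)^2\<close> is pulled
      out of the base so that the principal power splits.\<close>
    have w: "1 - z * complex_of_real ((sinh v)\<^sup>2 / (cosh v)\<^sup>2)
        = complex_of_real (1 / (cosh v)\<^sup>2) * (complex_of_real ((cosh v)\<^sup>2) - z * complex_of_real ((sinh v)\<^sup>2))"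
      using v by (simp add: field_simps)
    have "(2 * tanh v * (1 - (tanh v)\<^sup>2)) *\<^sub>R G ((tanh v)\<^sup>2)
      = complex_of_real (2 * (sinh v / cosh v) * (1 / (cosh v)\<^sup>2)) *
        (complex_of_real ((sinh v)\<^sup>2 / (cosh v)\<^sup>2) powr (b - 1) * complex_of_real (1 / (cosh v)\<^sup>2) powr (c - b - 1)
          * (complex_of_real (1 / (cosh v)\<^sup>2) * (complex_of_real ((cosh v)\<^sup>2) - z * complex_of_real ((sinh v)\<^sup>2))) powr (- a))
        * mittag_leffler3 \<alpha> \<beta> \<gamma> (complex_of_real (- p * (cosh v)\<^sup>2 * (cosh v / sinh v)\<^sup>2))"
      unfolding G_def scaleR_conv_of_real tanh(2) eqs arg w unfolding tanh(1) by (simp only: mult.assoc)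
    then have "(2 * tanh v * (1 - (tanh v)\<^sup>2)) *\<^sub>R G ((tanh v)\<^sup>2)
      = 2 * (complex_of_real (sinh v) powr (2 * b - 1)
             * complex_of_real (cosh v) powr (2 * a - 2 * c + 1)
             * (complex_of_real ((cosh v)\<^sup>2) - z * complex_of_real ((sinh v)\<^sup>2)) powr (- a)
             * mittag_leffler3 \<alpha> \<beta> \<gamma> (complex_of_real (- p * (cosh v)\<^sup>2 * (cosh v / sinh v)\<^sup>2)))"
      unfolding powr_hyperbolic_substitution[OF v] by (simp only: mult.assoc)
    then show "complex_of_real (sinh v) powr (2 * b - 1)
             * complex_of_real (cosh v) powr (2 * a - 2 * c + 1)
             * (complex_of_real ((cosh v)\<^sup>2) - z * complex_of_real ((sinh v)\<^sup>2)) powr (- a)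
             * mittag_leffler3 \<alpha> \<beta> \<gamma> (complex_of_real (- p * (cosh v)\<^sup>2 * (cosh v / sinh v)\<^sup>2))
       = ((2 * tanh v * (1 - (tanh v)\<^sup>2)) *\<^sub>R G ((tanh v)\<^sup>2)) / 2"
      by (rule half)
  qed auto

  show ?thesis
    using sums_summable[OF sums] J[unfolded G_def[abs_def]] H int_u int_sin H2 int_sinh by blast
qed

end
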